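(* Consider bilateral link formation with the smart adversary and any link cost $\alpha>0$. Let $G$ be the following graph on $17$ vertices: vertices $x,w,u,v,u'$ and a cycle on $12$ further vertices, one of which is called $y$; besides the $12$ cycle edges, the edges of $G$ are $\{x,w\}$, $\{w,u\}$, $e_1=\{w,v\}$, $\{u,v\}$, $e_2=\{v,y\}$, $\{v,u'\}$, $\{u',y\}$. Then the individual cost $C_v$ of player $v$ is not convex, since $$C_v(G-e_1-e_2)-C_v(G)\;<\;\big(C_v(G-e_1)-C_v(G)\big)+\big(C_v(G-e_2)-C_v(G)\big).$$
   Context: For a connected graph $G=(V,E)$, $e\in E$, $v\in V$, the relevance $\mathrm{rel}_G(e,v)$ is the number of vertices that, starting at $v$, can only be reached via $e$ (so it is $0$ iff $e$ is not a bridge). Let $\mathrm{sep}(e)=\sum_{z\in V}\mathrm{rel}_G(e,z)$, $\mathrm{sep}_{\max}=\max_{e\in E}\mathrm{sep}(e)$ and $E_{\max}=\{e\in E:\mathrm{sep}(e)=\mathrm{sep}_{\max}\}$. The smart adversary removes one edge chosen uniformly at random from $E_{\max}$; so the disconnection cost of $v$ in a connected graph $G$ is $I_v(G)=\frac{1}{|E_{\max}|}\sum_{e\in E_{\max}}\mathrm{rel}_G(e,v)$ (and $\infty$ if $G$ is disconnected). Under bilateral link formation both endpoints of each edge of the final graph pay $\alpha$ for it, so (for profiles without useless requests) the individual cost of $v$ is $C_v(G)=\alpha\deg_G(v)+I_v(G)$. $G-e$ denotes deletion of the edge $e$. Convexity of $C_v$ in a profile with final graph $G$ means that for any set $\{e_1,\dots,e_k\}$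 of edges of $G$ incident with $v$, $C_v(G-e_1-\dots-e_k)-C_v(G)\ge\sum_{i=1}^k(C_v(G-e_i)-C_v(G))$. *)

theory Defs
  imports Complex_Main "HOL-Library.Extended_Real"
begin

text \<open>
  A finite simple graph is given by its vertex set \<open>V\<close> and its edge set \<open>E\<close>, whose members
  are two-element subsets of \<open>V\<close>; deletion of the edge \<open>e\<close> yields \<open>V\<close> and \<open>E - {e}\<close>.
\<close>

fun walk_edges :: "'a list \<Rightarrow> 'a set list" where
  "walk_edges (a # b # p) = {a, b} # walk_edges (b # p)"
| "walk_edges _ = []"

definition walk :: "'a set \<Rightarrow> 'a set set \<Rightarrow> 'a \<Rightarrow> 'a list \<Rightarrow> 'a \<Rightarrow> bool" where
  "walk V E a p b \<longleftrightarrow>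
     p \<noteq> [] \<and> hd p = a \<and> last p = b \<and> set p \<subseteq> V \<and> set (walk_edges p) \<subseteq> E"

definition graph_connected :: "'a set \<Rightarrow> 'a set set \<Rightarrow> bool" where
  "graph_connected V E \<longleftrightarrow> (\<forall>a\<in>V. \<forall>b\<in>V. \<exists>p. walk V E a p b)"

definition degree :: "'a set set \<Rightarrow> 'a \<Rightarrow> nat" where
  "degree E v = card {e \<in> E. v \<in> e}"

text \<open>Relevance and everything built on it is meant for connected graphs only.\<close>

definition rel :: "'a set \<Rightarrow> 'a set set \<Rightarrow> 'a set \<Rightarrow> 'a \<Rightarrow> nat" where
  "rel V E e v = card {z \<in> V. \<forall>p. walk V E v p z \<longrightarrow> e \<in> set (walk_edges p)}"

definition sep :: "'a set \<Rightarrow> 'a set set \<Rightarrow> 'a set \<Rightarrow> nat" where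
  "sep V E e = (\<Sum>z\<in>V. rel V E e z)"

definition sep_max :: "'a set \<Rightarrow> 'a set set \<Rightarrow> nat" where
  "sep_max V E = Max (sep V E ` E)"

definition E_max :: "'a set \<Rightarrow> 'a set set \<Rightarrow> 'a set set" where
  "E_max V E = {e \<in> E. sep V E e = sep_max V E}"

definition disconnection_cost :: "'a set \<Rightarrow> 'a set set \<Rightarrow> 'a \<Rightarrow> ereal" where
  "disconnection_cost V E v =
     (if graph_connected V E
      then ereal (1 / real (card (E_max V E)) * (\<Sum>e\<in>E_max V E. real (rel V E e v)))
      else \<infinity>)"

text \<open>
  Under bilateral link formation both endpoints of every edge pay \<open>\<alpha>\<close> for it, so for profiles
  without useless requests the cost of a player depends on the final graph only.
\<close>

definition individual_cost :: "real \<Rightarrow> 'a set \<Rightarrow> 'a set set \<Rightarrow> 'a \<Rightarrow> ereal" where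
  "individual_cost \<alpha> V E v = ereal (\<alpha> * real (degree E v)) + disconnection_cost V E v"

text \<open>
  Meant for connected final graphs, where the cost is finite and the differences below
  cannot have the form \<open>\<infinity> - \<infinity>\<close>.
\<close>

definition cost_convex :: "real \<Rightarrow> 'a set \<Rightarrow> 'a set set \<Rightarrow> 'a \<Rightarrow> bool" where
  "cost_convex \<alpha> V E v \<longleftrightarrow>
     (\<forall>F \<subseteq> {e \<in> E. v \<in> e}.
        individual_cost \<alpha> V (E - F) v - individual_cost \<alpha> V E v
          \<ge> (\<Sum>e\<in>F. individual_cost \<alpha> V (E - {e}) v - individual_cost \<alpha> V E v))"

definition cycle_edges :: "'a list \<Rightarrow> 'a set set" where
  "cycle_edges cs = {{cs ! i, cs ! (Suc i mod length cs)} | i. i < length cs}"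

end

theory Submission
  imports Defs
begin

text \<open>
  Deleting \<open>e1\<close> opens the left triangle and deleting \<open>e2\<close> the right one. In \<open>G\<close> the only bridge is
  \<open>{x, w}\<close>, of relevance \<open>1\<close> for \<open>v\<close>. In \<open>G - e1\<close> the bridge with the largest separation
  is \<open>{u, v}\<close> (\<open>2 \<cdot> 3 \<cdot> 14 = 84\<close>), of relevance \<open>3\<close>. In both \<open>G - e2\<close> and \<open>G - e1 - e2\<close>
  it is \<open>{u', y}\<close> (\<open>2 \<cdot> 5 \<cdot> 12 = 120\<close>), of relevance \<open>12\<close>, so once \<open>e2\<close> is gone the
  adversary no longer profits from the deletion of \<open>e1\<close>: the increments are
  \<open>11 - 2 \<alpha>\<close> against \<open>(2 - \<alpha>) + (11 - \<alpha>)\<close>.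
\<close>

section \<open>Reachability\<close>

text \<open>Both endpoints must lie in \<open>V\<close>, as in \<open>walk\<close>, so that
  reachability and the existence of a walk from a vertex of \<open>V\<close> coincide.\<close>

definition adj :: "'a set \<Rightarrow> 'a set set \<Rightarrow> ('a \<times> 'a) set" where
  "adj V E = {(a, b). a \<in> V \<and> b \<in> V \<and> {a, b} \<in> E}"

text \<open>Connecting paths may leave \<open>S\<close>, so this is weaker than connectivity of the
  subgraph induced on \<open>S\<close>.\<close>

definition linked :: "'a set \<Rightarrow> 'a set set \<Rightarrow> 'a set \<Rightarrow> bool" where
  "linked V E S \<longleftrightarrow> S \<times> S \<subseteq> (adj V E)\<^sup>*"

lemma walk_edges_snoc:
  "p \<noteq> [] \<Longrightarrow> walk_edges (p @ [c]) = walk_edges p @ [{last p, c}]"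
  by (induction p rule: walk_edges.induct) auto

lemma walk_imp_reachable: "walk V E a p b \<Longrightarrow> (a, b) \<in> (adj V E)\<^sup>*"
proof (induction p arbitrary: a rule: walk_edges.induct)
  case (1 c d p)
  then have "(c, d) \<in> adj V E" "walk V E d (d # p) b" "a = c"
    by (auto simp: walk_def adj_def)
  with 1 show ?case
    by (meson converse_rtrancl_into_rtrancl)
qed (auto simp: walk_def)

lemma reachable_imp_walk:
  assumes "(a, b) \<in> (adj V E)\<^sup>*" and "a \<in> V"
  shows "\<exists>p. walk V E a p b"
  using assms(1)
proof (induction rule: rtrancl_induct)
  case base
  have "walk V E a [a] a"
    using assms(2) by (simp add: walk_def)
  then show ?case ..
next
  case (step c d)
  then obtain p where "walk V E a p c"
    by blast
  with step(2) have "walk V E a (p @ [d]) d"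
    by (auto simp: walk_def adj_def walk_edges_snoc)
  then show ?case ..
qed

lemma reachable_sym: "(a, b) \<in> (adj V E)\<^sup>* \<Longrightarrow> (b, a) \<in> (adj V E)\<^sup>*"
proof -
  have "sym (adj V E)"
    by (auto simp: sym_def adj_def insert_commute)
  then show "(a, b) \<in> (adj V E)\<^sup>* \<Longrightarrow> (b, a) \<in> (adj V E)\<^sup>*"
    by (meson sym_rtrancl symD)
qed

lemma adj_mono: "E \<subseteq> F \<Longrightarrow> adj V E \<subseteq> adj V F"
  by (auto simp: adj_def)

lemma linked_mono: "linked V E S \<Longrightarrow> E \<subseteq> F \<Longrightarrow> linked V F S"
  unfolding linked_def using rtrancl_mono[OF adj_mono] by blast

lemma linked_empty: "linked V E {}"
  and linked_singleton: "linked V E {a}"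
  by (auto simp: linked_def)

text \<open>Reachability is symmetric, so any two members of \<open>S\<close> are joined through the
  root \<open>r\<close>, which may itself lie outside \<open>S\<close>.\<close>

lemma linkedI: "(\<And>a. a \<in> S \<Longrightarrow> (r, a) \<in> (adj V E)\<^sup>*) \<Longrightarrow> linked V E S"
  unfolding linked_def by (auto intro: rtrancl_trans[OF reachable_sym])

lemma linked_insert:
  assumes "linked V E S" and "a \<in> S" and "{a, b} \<in> E" and "a \<in> V" and "b \<in> V"
  shows "linked V E (insert b S)"
proof (rule linkedI[of _ a])
  have "(a, b) \<in> (adj V E)\<^sup>*"
    using assms by (auto simp: adj_def)
  then show "(a, c) \<in> (adj V E)\<^sup>*" if "c \<in> insert b S" for c
    using assms that by (auto simp: linked_def)
qed

text \<open>Each edge of the walk attaches one more vertex. Connectivity claims thus reduce to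
  exhibiting a list of vertices, in which repetitions are harmless.\<close>

lemma linked_walk:
  "linked V E S \<Longrightarrow> a \<in> S \<Longrightarrow> walk V E a p b \<Longrightarrow> linked V E (S \<union> set p)"
proof (induction p arbitrary: a S rule: walk_edges.induct)
  case (1 c d p)
  from 1(4) have step: "a = c" "{c, d} \<in> E" "c \<in> V" "d \<in> V" and rest: "walk V E d (d # p) b"
    by (auto simp: walk_def)
  have "c \<in> S"
    using 1(3) step(1) by simp
  with 1(2) have "linked V E (insert d S)"
    using step(2-4) by (rule linked_insert)
  from "1.IH"[OF this _ rest] have "linked V E (insert d S \<union> set (d # p))"
    by blast
  moreover have "S \<union> set (c # d # p) = insert d S \<union> set (d # p)"
    using 1(3) step(1) by auto
  ultimately show ?case
    by simp
qed (auto simp: walk_def insert_absorb)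

lemma linked_walk_vertices:
  assumes "walk V E a p b"
  shows "linked V E (set p)"
proof -
  have "a \<in> set p"
    using assms unfolding walk_def by (metis hd_in_set)
  then show ?thesis
    using linked_walk[OF linked_singleton singletonI assms] by (simp add: insert_absorb)
qed

lemma graph_connected_if_linked:
  assumes "linked V E V"
  shows "graph_connected V E"
  unfolding graph_connected_def
proof (intro ballI)
  fix a b assume "a \<in> V" "b \<in> V"
  then show "\<exists>p. walk V E a p b"
    using assms by (intro reachable_imp_walk) (auto simp: linked_def)
qed

section \<open>Relevance and separation\<close>

text \<open>A walk that avoids \<open>e\<close> is the same as a walk in the graph without
  \<open>e\<close>.\<close>

lemma rel_eq_card_unreachable:
  assumes "v \<in> V"
  shows "rel V E e v = card {z \<in> V. (v, z) \<notin> (adj V (E - {e}))\<^sup>*}"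
proof -
  have "walk V (E - {e}) v p z \<longleftrightarrow> walk V E v p z \<and> e \<notin> set (walk_edges p)" for p z
    by (auto simp: walk_def)
  then have "(\<forall>p. walk V E v p z \<longrightarrow> e \<in> set (walk_edges p)) \<longleftrightarrow> (v, z) \<notin> (adj V (E - {e}))\<^sup>*"
    for z
    using walk_imp_reachable[of V "E - {e}" v _ z] reachable_imp_walk[of v z V "E - {e}"] assms
    by blast
  then show ?thesis
    by (simp add: rel_def)
qed

text \<open>All of \<open>A\<close> stays reachable, so only members of \<open>B\<close> can be
  lost. Whether \<open>e\<close> really separates \<open>A\<close> from \<open>B\<close> is left
  open, so the bound serves bridges and non-bridges alike.\<close>

lemma rel_le:
  assumes "finite B" and "linked V (E - {e}) A" and "V = A \<union> B" and "v \<in> A"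
  shows "rel V E e v \<le> card B"
proof -
  have "{z \<in> V. (v, z) \<notin> (adj V (E - {e}))\<^sup>*} \<subseteq> B"
    using assms by (auto simp: linked_def)
  then show ?thesis
    using assms by (simp add: rel_eq_card_unreachable card_mono)
qed

text \<open>No edge other than \<open>e\<close> crosses the cut, so after the deletion the component
  of \<open>v\<close> is exactly \<open>A\<close>.\<close>

lemma rel_bridge:
  assumes "linked V (E - {e}) A" and "V = A \<union> B" and "A \<inter> B = {}"
    and no_crossing: "\<And>f. f \<in> E - {e} \<Longrightarrow> f \<subseteq> A \<or> f \<subseteq> B" and "v \<in> A"
  shows "rel V E e v = card B"
proof -
  have "z \<in> A" if "(v, z) \<in> (adj V (E - {e}))\<^sup>*" for z
    using that
  proof (induction rule: rtrancl_induct)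
    case (step c d)
    then have "{c, d} \<subseteq> A \<or> {c, d} \<subseteq> B"
      by (intro no_crossing) (auto simp: adj_def)
    with step(3) assms(3) show ?case
      by auto
  qed (use assms in simp)
  then have "{z \<in> V. (v, z) \<notin> (adj V (E - {e}))\<^sup>*} = B"
    using assms by (auto simp: linked_def)
  then show ?thesis
    using assms by (simp add: rel_eq_card_unreachable)
qed

text \<open>Each vertex of \<open>A\<close> loses at most \<open>B\<close> and each vertex of
  \<open>B\<close> at most \<open>A\<close>, so the product of the sizes is counted twice. An empty
  \<open>B\<close> yields the value 0 of a non-bridge.\<close>

lemma sep_le:
  assumes "finite V" and "linked V (E - {e}) A" and "linked V (E - {e}) B"
    and "V = A \<union> B" and "A \<inter> B = {}"
  shows "sep V E e \<le> 2 * card A * card B"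
proof -
  have fin: "finite A" "finite B"
    using assms by auto
  have "sep V E e = (\<Sum>z\<in>A. rel V E e z) + (\<Sum>z\<in>B. rel V E e z)"
    unfolding sep_def assms(4) using fin assms(5) by (rule sum.union_disjoint)
  also have "\<dots> \<le> of_nat (card A) * card B + of_nat (card B) * card A"
    using assms fin by (intro add_mono sum_bounded_above rel_le) auto
  finally show ?thesis
    by (simp add: algebra_simps)
qed

lemma sep_bridge:
  assumes "finite V" and "linked V (E - {e}) A" and "linked V (E - {e}) B"
    and "V = A \<union> B" and "A \<inter> B = {}"
    and "\<And>f. f \<in> E - {e} \<Longrightarrow> f \<subseteq> A \<or> f \<subseteq> B"
  shows "sep V E e = 2 * card A * card B"
proof -
  have fin: "finite A" "finite B"
    using assms by auto
  have "sep V E e = (\<Sum>z\<in>A. rel V E e z) + (\<Sum>z\<in>B. rel V E e z)"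
    unfolding sep_def assms(4) using fin assms(5) by (rule sum.union_disjoint)
  also have "(\<Sum>z\<in>A. rel V E e z) = (\<Sum>z\<in>A. card B)"
    using assms by (intro sum.cong rel_bridge) auto
  also have "(\<Sum>z\<in>B. rel V E e z) = (\<Sum>z\<in>B. card A)"
    using assms by (intro sum.cong rel_bridge[where A = B and B = A]) blast+
  finally show ?thesis
    by (simp add: algebra_simps)
qed

text \<open>With fewer edges, the loss of \<open>e\<close> leaves every vertex with at least as many
  unreachable vertices.\<close>

lemma sep_antimono:
  assumes "finite V" and "F \<subseteq> E"
  shows "sep V E e \<le> sep V F e"
  unfolding sep_def
proof (rule sum_mono)
  fix z assume z: "z \<in> V"
  have "(adj V (F - {e}))\<^sup>* \<subseteq> (adj V (E - {e}))\<^sup>*"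
    using assms by (intro rtrancl_mono adj_mono) auto
  then show "rel V E e z \<le> rel V F e z"
    using z assms by (auto simp: rel_eq_card_unreachable intro!: card_mono)
qed

lemma E_max_eq_singleton:
  assumes "finite E" and "b \<in> E" and "\<And>f. f \<in> E \<Longrightarrow> f \<noteq> b \<Longrightarrow> sep V E f < sep V E b"
  shows "E_max V E = {b}"
proof -
  have "sep_max V E = sep V E b"
    unfolding sep_max_def using assms by (intro Max_eqI) (auto intro: less_imp_le)
  then show ?thesis
    using assms by (fastforce simp: E_max_def)
qed

text \<open>A unique maximiser reduces the average over \<open>E_max\<close> to a single
  term.\<close>

lemma individual_cost_unique_target:
  assumes "linked V E V" and "finite E" and "b \<in> E"
    and "\<And>f. f \<in> E \<Longrightarrow> f \<noteq> b \<Longrightarrow> sep V E f < sep V E b"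
  shows "individual_cost \<alpha> V E v = ereal (\<alpha> * real (degree E v) + real (rel V E b v))"
  using E_max_eq_singleton[OF assms(2-4)] graph_connected_if_linked[OF assms(1)]
  by (simp add: individual_cost_def disconnection_cost_def)

lemma degree_insert:
  assumes "finite F" and "f \<notin> F"
  shows "degree (insert f F) v = (if v \<in> f then Suc (degree F v) else degree F v)"
proof -
  have "{e \<in> insert f F. v \<in> e} =
      (if v \<in> f then insert f {e \<in> F. v \<in> e} else {e \<in> F. v \<in> e})"
    by auto
  then show ?thesis
    using assms by (simp add: degree_def)
qed

section \<open>Cycles\<close>

lemma cycle_edges_subset: "e \<in> cycle_edges cs \<Longrightarrow> e \<subseteq> set cs"
  unfolding cycle_edges_def
  by (auto intro!: nth_mem mod_less_divisor)

lemma finite_cycle_edges: "finite (cycle_edges cs)"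
  by (simp add: cycle_edges_def)

text \<open>Distinct indices of the same edge would be cyclic successors of each other, which forces
  the length to divide 2.\<close>

lemma cycle_edge_inj:
  assumes "distinct cs" and "3 \<le> length cs" and "i < length cs" and "j < length cs"
    and "{cs ! i, cs ! (Suc i mod length cs)} = {cs ! j, cs ! (Suc j mod length cs)}"
  shows "i = j"
proof (rule ccontr)
  let ?n = "length cs"
  assume "i \<noteq> j"
  then have "cs ! i \<noteq> cs ! j"
    using assms(1,3,4) nth_eq_iff_index_eq by blast
  then have "cs ! i = cs ! (Suc j mod ?n)" "cs ! j = cs ! (Suc i mod ?n)"
    using assms(5) by (auto simp only: doubleton_eq_iff)
  moreover have "Suc i mod ?n < ?n" "Suc j mod ?n < ?n"
    using assms(2) by (auto intro: mod_less_divisor)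
  ultimately have "i = Suc j mod ?n" "j = Suc i mod ?n"
    using assms(1,3,4) nth_eq_iff_index_eq by blast+
  with assms(3,4) have "i = 0 \<and> Suc j = ?n \<or> i = Suc j" "j = 0 \<and> Suc i = ?n \<or> j = Suc i"
    by (metis Suc_lessI mod_less mod_self)+
  with assms(2) show False
    by linarith
qed

lemma linked_cycle_minus_edge:
  assumes "distinct cs" and "3 \<le> length cs" and "set cs \<subseteq> V"
  shows "linked V (cycle_edges cs - {e}) (set cs)"
proof -
  let ?n = "length cs"
  have cut: "linked V (cycle_edges cs - {{cs ! i, cs ! (Suc i mod ?n)}}) (set cs)"
    (is "linked V ?F _") if i: "i < ?n" for i
  \<comment> \<open>The root is the far endpoint of the deleted edge: going forward from it reaches
    the whole cycle before that edge would be used.\<close>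
  proof (rule linkedI[of _ "cs ! ((i + 1) mod ?n)"])
    have reach: "(cs ! ((i + 1) mod ?n), cs ! ((i + 1 + k) mod ?n)) \<in> (adj V ?F)\<^sup>*"
      if "k < ?n" for k
      using that
    proof (induction k)
      case (Suc k)
      let ?j = "(i + 1 + k) mod ?n"
      have j: "?j < ?n" "Suc ?j mod ?n = (i + 1 + Suc k) mod ?n"
        using i by (auto simp: mod_Suc_eq intro!: mod_less_divisor)
      \<comment> \<open>Returning to index \<open>i\<close> takes \<open>?n - 1\<close> steps from
        the root, but here \<open>k < ?n - 1\<close>.\<close>
      have "?j \<noteq> i"
      proof (cases "i + 1 + k < ?n")
        case False
        then have "?j = i + 1 + k - ?n"
          using i Suc.prems by (simp add: mod_if)
        then show ?thesis
          using Suc.prems False by linarith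
      qed simp
      then have "{cs ! ?j, cs ! (Suc ?j mod ?n)} \<in> ?F"
        using cycle_edge_inj[OF assms(1,2) j(1) i] j(1) unfolding cycle_edges_def by blast
      moreover have "cs ! ?j \<in> V" "cs ! (Suc ?j mod ?n) \<in> V"
        using j(1) by (auto intro!: subsetD[OF assms(3)] nth_mem mod_less_divisor)
      ultimately have "(cs ! ?j, cs ! (Suc ?j mod ?n)) \<in> adj V ?F"
        by (simp add: adj_def)
      with Suc.IH[OF Suc_lessD[OF Suc.prems]]
      have "(cs ! ((i + 1) mod ?n), cs ! (Suc ?j mod ?n)) \<in> (adj V ?F)\<^sup>*"
        by (rule rtrancl_into_rtrancl)
      then show ?case
        unfolding j(2) .
    qed simp
    fix a assume "a \<in> set cs"
    then obtain m where m: "m < ?n" "a = cs ! m"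
      by (metis in_set_conv_nth)
    \<comment> \<open>This is the forward distance from the root to \<open>m\<close>; adding
      \<open>?n\<close> keeps the subtraction of naturals from truncating.\<close>
    define k where "k = (m + ?n - (i + 1)) mod ?n"
    have "(i + 1 + k) mod ?n = (i + 1 + (m + ?n - (i + 1))) mod ?n"
      unfolding k_def by (rule mod_add_right_eq)
    also have "i + 1 + (m + ?n - (i + 1)) = m + ?n"
      using i by simp
    also have "(m + ?n) mod ?n = m"
      using m by simp
    finally have km: "(i + 1 + k) mod ?n = m" .
    have "k < ?n"
      unfolding k_def by (rule mod_less_divisor) (use i in linarith)
    from reach[OF this] show "(cs ! ((i + 1) mod ?n), a) \<in> (adj V ?F)\<^sup>*"
      unfolding km m(2) .
  qed
  show ?thesis
  proof (cases "e \<in> cycle_edges cs")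
    case True
    then obtain i where "i < ?n" "e = {cs ! i, cs ! (Suc i mod ?n)}"
      unfolding cycle_edges_def by blast
    then show ?thesis
      using cut by blast
  next
    case False
    \<comment> \<open>If \<open>e\<close> is not on the cycle, cutting at index 0 already leaves a
      subset of the available edges.\<close>
    have "0 < ?n"
      using assms(2) by linarith
    from cut[OF this] show ?thesis
      by (rule linked_mono) (use False in blast)
  qed
qed

section \<open>The counterexample\<close>

theorem proposition10p9:
  fixes \<alpha> :: real
    and x w u v u' y :: 'a
    and cs :: "'a list"
    and V :: "'a set" and E :: "'a set set" and e1 e2 :: "'a set"
  assumes "\<alpha> > 0"
    and "distinct ([x, w, u, v, u'] @ cs)" and "length cs = 12" and "y \<in> set cs"
    and "e1 = {w, v}" and "e2 = {v, y}"
    and "V = {x, w, u, v, u'} \<union> set cs"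
    and "E = cycle_edges cs \<union> {{x, w}, {w, u}, e1, {u, v}, e2, {v, u'}, {u', y}}"
  shows "\<not> cost_convex \<alpha> V E v \<and>
    individual_cost \<alpha> V (E - {e1, e2}) v - individual_cost \<alpha> V E v
      < (individual_cost \<alpha> V (E - {e1}) v - individual_cost \<alpha> V E v)
        + (individual_cost \<alpha> V (E - {e2}) v - individual_cost \<alpha> V E v)"
proof -

  \<comment> \<open>The four graphs as explicit edge sets\<close>
  define C where "C = set cs"
  define K where "K = cycle_edges cs"
  have C: "finite C" "card C = 12" "y \<in> C" "{x, w, u, v, u'} \<inter> C = {}" "C \<subseteq> V"
    using assms by (auto simp: C_def distinct_card)
  have ne: "distinct [x, w, u, v, u', y]"
    using assms by auto
  have V: "V = {x, w, u, v, u'} \<union> C"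
    using assms by (simp add: C_def)
  have finV: "finite V"
    using C V by simp
  have K_sub: "e \<subseteq> C" if "e \<in> K" for e
    using that cycle_edges_subset by (simp add: K_def C_def)
  have finK: "finite K"
    by (simp add: K_def finite_cycle_edges)
  have K_notin: "{a, b} \<notin> K" "{b, a} \<notin> K" if "a \<in> {x, w, u, v, u'}" for a b
    using K_sub C(4) that by blast+
  have E: "E = K \<union> {{x, w}, {w, u}, {w, v}, {u, v}, {v, y}, {v, u'}, {u', y}}"
    using assms by (simp add: K_def)
  define E1 where "E1 = K \<union> {{x, w}, {w, u}, {u, v}, {v, y}, {v, u'}, {u', y}}"
  define E2 where "E2 = K \<union> {{x, w}, {w, u}, {w, v}, {u, v}, {v, u'}, {u', y}}"
  define E12 where "E12 = K \<union> {{x, w}, {w, u}, {u, v}, {v, u'}, {u', y}}"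
  have del: "E - {e1} = E1" "E - {e2} = E2" "E - {e1, e2} = E12"
    unfolding E E1_def E2_def E12_def assms(5,6)
    using ne K_notin by (auto simp: doubleton_eq_iff)
  have sub: "E12 \<subseteq> E1" "E12 \<subseteq> E2" "E1 \<subseteq> E" "E2 \<subseteq> E"
    by (auto simp: E E1_def E2_def E12_def)
  have fin: "finite E" "finite E1" "finite E2" "finite E12"
    using finK by (auto simp: E E1_def E2_def E12_def)

  \<comment> \<open>Connectivity of the graphs and of the two sides of each cut\<close>
  have cyc: "linked V F C" if "K - {e} \<subseteq> F" for e F
    using linked_cycle_minus_edge[of cs V e] assms that linked_mono
    by (fastforce simp: C_def K_def)
  \<comment> \<open>The reversed list supplies each disequality in the opposite orientation.\<close>
  have facts: "x \<notin> C" "w \<notin> C" "u \<notin> C" "v \<notin> C" "u' \<notin> C" "y \<in> C"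
    "distinct [x, w, u, v, u', y]" "distinct (rev [x, w, u, v, u', y])"
    using C(3,4) ne by auto
  note edges = walk_def V doubleton_eq_iff

  have from_x: "linked V F S" if "walk V F x p b" "set p = S" for F p b S
    using linked_walk_vertices that by metis
  \<comment> \<open>The cycle stays linked after losing any one edge, so a walk from
    \<open>y\<close> only has to collect the vertices outside it.\<close>
  have from_y: "linked V F S" if "K - {e} \<subseteq> F" "walk V F y p b" "C \<union> set p = S" for F e p b S
    using linked_walk[OF cyc[OF that(1)] C(3) that(2)] that(3) by simp

  have sep_0: "sep V F e = 0" if "linked V (F - {e}) V" for F e
    using sep_le[OF finV that linked_empty] by simp

  \<comment> \<open>Separation is antitone in the edge set, so an upper bound found in \<open>G - e1 - e2\<close> (\<open>E12\<close>)
    holds in all four graphs.\<close>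
  have conn_K: "linked V (E12 - {k}) V" if "k \<in> K" for k
    using that facts K_notin
    by (intro from_y[of k _ "[y, u', v, u, w, x]" x]) (auto simp: edges E12_def)
  \<comment> \<open>\<open>E12\<close> is the cycle with the path \<open>y, u', v, u, w, x\<close>
    attached at \<open>y\<close>. The edge \<open>{}\<close> does not occur in \<open>K\<close>, so
    here the cycle is kept whole.\<close>
  have conn_E12: "linked V E12 V"
    using facts
    by (intro from_y[of "{}" _ "[y, u', v, u, w, x]" x]) (auto simp: edges E12_def)
  have conn: "linked V F V" if "E12 \<subseteq> F" for F
    using conn_E12 that by (rule linked_mono)
  have sep_K: "sep V F k = 0" if "k \<in> K" "E12 \<subseteq> F" for F k
    using sep_antimono[OF finV that(2), of k] sep_0[OF conn_K[OF that(1)]] by simp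

  \<comment> \<open>Each of the five path edges cuts \<open>E12\<close> into a piece containing
    \<open>x\<close>, covered by a walk from \<open>x\<close>, and a piece containing the cycle,
    covered from \<open>y\<close>.\<close>
  have xw: "linked V (E12 - {{x, w}}) {x}" "linked V (E12 - {{x, w}}) ({w, u, v, u'} \<union> C)"
    subgoal
      using facts
      by (intro from_x[of _ "[x]" x]) (auto simp: edges E12_def)
    subgoal
      using facts K_notin
      by (intro from_y[of "{x, w}" _ "[y, u', v, u, w]" w]) (auto simp: edges E12_def)
    done
  have wu: "linked V (E12 - {{w, u}}) {x, w}" "linked V (E12 - {{w, u}}) ({u, v, u'} \<union> C)"
    subgoal
      using facts
      by (intro from_x[of _ "[x, w]" w]) (auto simp: edges E12_def)
    subgoal
      using facts K_notin
      by (intro from_y[of "{w, u}" _ "[y, u', v, u]" u]) (auto simp: edges E12_def)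
    done
  have uv: "linked V (E12 - {{u, v}}) {x, w, u}" "linked V (E12 - {{u, v}}) ({v, u'} \<union> C)"
    subgoal
      using facts
      by (intro from_x[of _ "[x, w, u]" u]) (auto simp: edges E12_def)
    subgoal
      using facts K_notin
      by (intro from_y[of "{u, v}" _ "[y, u', v]" v]) (auto simp: edges E12_def)
    done
  have vu': "linked V (E12 - {{v, u'}}) {x, w, u, v}" "linked V (E12 - {{v, u'}}) ({u'} \<union> C)"
    subgoal
      using facts
      by (intro from_x[of _ "[x, w, u, v]" v]) (auto simp: edges E12_def)
    subgoal
      using facts K_notin
      by (intro from_y[of "{v, u'}" _ "[y, u']" u']) (auto simp: edges E12_def)
    done
  have u'y: "linked V (E12 - {{u', y}}) {x, w, u, v, u'}" "linked V (E12 - {{u', y}}) C"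
    subgoal
      using facts
      by (intro from_x[of _ "[x, w, u, v, u']" u']) (auto simp: edges E12_def)
    subgoal
      using facts K_notin
      by (intro from_y[of "{u', y}" _ "[y]" y]) (auto simp: edges E12_def)
    done
  \<comment> \<open>The left triangle \<open>w, u, v\<close> is intact in \<open>E2\<close> and the
    right triangle \<open>v, u', y\<close> in \<open>E1\<close>. These four walks bypass a missing
    triangle edge through the other two, retracing an edge to visit every vertex.\<close>
  have wu': "linked V (E2 - {{w, u}}) V"
    using facts K_notin
    by (intro from_y[of "{w, u}" _ "[y, u', v, u, v, w, x]" x]) (auto simp: edges E2_def)
  have uv': "linked V (E2 - {{u, v}}) V"
    using facts K_notin
    by (intro from_y[of "{u, v}" _ "[y, u', v, w, u, w, x]" x]) (auto simp: edges E2_def)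
  have vu'': "linked V (E1 - {{v, u'}}) V"
    using facts K_notin
    by (intro from_y[of "{v, u'}" _ "[y, u', y, v, u, w, x]" x]) (auto simp: edges E1_def)
  have u'y': "linked V (E1 - {{u', y}}) V"
    using facts K_notin
    by (intro from_y[of "{u', y}" _ "[y, v, u', v, u, w, x]" x]) (auto simp: edges E1_def)

  \<comment> \<open>Upper bounds on separation, valid in all four graphs\<close>
  have cards: "card ({w, u, v, u'} \<union> C) = 16" "card {x, w} = 2" "card ({u, v, u'} \<union> C) = 15"
    "card {x, w, u} = 3" "card ({v, u'} \<union> C) = 14" "card {x, w, u, v} = 4"
    "card ({u'} \<union> C) = 13" "card {x, w, u, v, u'} = 5"
    using facts C(1,2) by auto
  have bound: "sep V F e \<le> 2 * card A * card B"
    if "E12 \<subseteq> F" "linked V (E12 - {e}) A" "linked V (E12 - {e}) B" "A \<union> B = V" "A \<inter> B = {}"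
    for F e A B
    using sep_antimono[OF finV that(1), of e] sep_le[OF finV that(2,3)] that(4,5)
    by (meson le_trans)
  have sep_wu: "sep V F {w, u} \<le> 60" if "E12 \<subseteq> F" for F
  proof -
    have "sep V F {w, u} \<le> 2 * card {x, w} * card ({u, v, u'} \<union> C)"
      using facts by (intro bound[OF that wu]) (auto simp: V)
    then show ?thesis
      unfolding cards by simp
  qed
  have sep_uv: "sep V F {u, v} \<le> 84" if "E12 \<subseteq> F" for F
  proof -
    have "sep V F {u, v} \<le> 2 * card {x, w, u} * card ({v, u'} \<union> C)"
      using facts by (intro bound[OF that uv]) (auto simp: V)
    then show ?thesis
      unfolding cards by simp
  qed
  have sep_vu': "sep V F {v, u'} \<le> 104" if "E12 \<subseteq> F" for F
  proof -
    have "sep V F {v, u'} \<le> 2 * card {x, w, u, v} * card ({u'} \<union> C)"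
      using facts by (intro bound[OF that vu']) (auto simp: V)
    then show ?thesis
      unfolding cards by simp
  qed
  have sep_xw: "sep V F {x, w} \<le> 32" if "E12 \<subseteq> F" for F
  proof -
    have "sep V F {x, w} \<le> 2 * card {x} * card ({w, u, v, u'} \<union> C)"
      using facts by (intro bound[OF that xw]) (auto simp: V)
    then show ?thesis
      unfolding cards by simp
  qed

  \<comment> \<open>Exact separation and relevance of the targets\<close>
  have linked_del: "linked V (F - {e}) S" if "linked V (E12 - {e}) S" "E12 \<subseteq> F" for F e S
    by (rule linked_mono[OF that(1)]) (use that(2) in blast)
  have E_xw: "sep V E {x, w} = 32" "rel V E {x, w} v = 1"
  proof -
    \<comment> \<open>Competing edges only need upper bounds; the target needs its exact value,
      hence the check that no other edge crosses the cut.\<close>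
    have cross: "f \<subseteq> {x} \<or> f \<subseteq> {w, u, v, u'} \<union> C" if "f \<in> E - {{x, w}}" for f
      using that K_sub C(3) by (auto simp: E)
    have "E12 \<subseteq> E"
      using sub by blast
    note L = xw[THEN linked_del, OF this]
    have "sep V E {x, w} = 2 * card {x} * card ({w, u, v, u'} \<union> C)"
      using facts by (intro sep_bridge[OF finV L _ _ cross]) (auto simp: V)
    then show "sep V E {x, w} = 32"
      unfolding cards by simp
    have "rel V E {x, w} v = card {x}"
      using cross facts by (intro rel_bridge[OF L(2)]) (auto simp: V)
    then show "rel V E {x, w} v = 1"
      by simp
  qed
  have E1_uv: "sep V E1 {u, v} = 84" "rel V E1 {u, v} v = 3"
  proof -
    have cross: "f \<subseteq> {x, w, u} \<or> f \<subseteq> {v, u'} \<union> C" if "f \<in> E1 - {{u, v}}" for f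
      using that K_sub C(3) by (auto simp: E1_def)
    note L = uv[THEN linked_del, OF sub(1)]
    have "sep V E1 {u, v} = 2 * card {x, w, u} * card ({v, u'} \<union> C)"
      using facts by (intro sep_bridge[OF finV L _ _ cross]) (auto simp: V)
    then show "sep V E1 {u, v} = 84"
      unfolding cards by simp
    have "rel V E1 {u, v} v = card {x, w, u}"
      using cross facts by (intro rel_bridge[OF L(2)]) (auto simp: V)
    then show "rel V E1 {u, v} v = 3"
      unfolding cards .
  qed
  \<comment> \<open>Once \<open>e2\<close> is gone, \<open>{u', y}\<close> is the only edge leaving
    the cycle, whether or not \<open>e1\<close> is present. One argument therefore covers
    \<open>E2\<close> and \<open>E12\<close>.\<close>
  have E2_u'y: "sep V F {u', y} = 120" "rel V F {u', y} v = 12" if F: "E12 \<subseteq> F" "F \<subseteq> E2" for F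
  proof -
    have cross: "f \<subseteq> {x, w, u, v, u'} \<or> f \<subseteq> C" if "f \<in> F - {{u', y}}" for f
      using that K_sub C(3) F(2) by (auto simp: E2_def)
    note L = u'y[THEN linked_del, OF F(1)]
    show "sep V F {u', y} = 120"
      using sep_bridge[OF finV L V C(4) cross] C(2) cards by simp
    show "rel V F {u', y} v = 12"
      using rel_bridge[OF L(1) V C(4) cross] C(2) by simp
  qed

  have deg: "degree E v = 4" "degree E1 v = 3" "degree E2 v = 3" "degree E12 v = 2"
  proof -
    have "{e \<in> K. v \<in> e} = {}"
      using K_sub facts(4) by blast
    then have "degree K v = 0"
      unfolding degree_def by (simp only: card.empty)
    then show "degree E v = 4" "degree E1 v = 3" "degree E2 v = 3" "degree E12 v = 2"
      using facts K_notin finK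
      by (simp_all add: degree_insert E E1_def E2_def E12_def doubleton_eq_iff)
  qed

  \<comment> \<open>Cost of \<open>v\<close> in the four graphs\<close>
  have "individual_cost \<alpha> V E v = ereal (\<alpha> * real (degree E v) + real (rel V E {x, w} v))"
  proof (rule individual_cost_unique_target[OF conn fin(1)])
    fix f assume f: "f \<in> E" "f \<noteq> {x, w}"
    have "sep V E f = 0"
    proof -
      \<comment> \<open>\<open>e1\<close> and \<open>e2\<close> are not bridges of \<open>G\<close>,
        because \<open>E1\<close> and \<open>E2\<close> are connected.\<close>
      have "sep V E {w, v} = 0" "sep V E {v, y} = 0"
        using conn[of E1] conn[of E2] del sub assms(5,6) by (auto intro!: sep_0)
      moreover have "sep V E {w, u} = 0" "sep V E {u, v} = 0"
        \<comment> \<open>A non-bridge of a spanning subgraph remains a non-bridge when edges are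
          added.\<close>
        using sep_antimono[OF finV sub(4)] sep_0[OF wu'] sep_0[OF uv'] by (metis le_zero_eq)+
      moreover have "sep V E {v, u'} = 0" "sep V E {u', y} = 0"
        using sep_antimono[OF finV sub(3)] sep_0[OF vu''] sep_0[OF u'y'] by (metis le_zero_eq)+
      moreover have "sep V E f = 0" if "f \<in> K"
        using sep_K[OF that, of E] sub by blast
      ultimately show ?thesis
        using f unfolding E by blast
    qed
    then show "sep V E f < sep V E {x, w}"
      by (simp add: E_xw)
  qed (use sub in \<open>auto simp: E\<close>)
  then have cost: "individual_cost \<alpha> V E v = ereal (4 * \<alpha> + 1)"
    by (simp add: deg E_xw)

  have "individual_cost \<alpha> V E1 v = ereal (\<alpha> * real (degree E1 v) + real (rel V E1 {u, v} v))"
  proof (rule individual_cost_unique_target[OF conn fin(2)])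
    fix f assume f: "f \<in> E1" "f \<noteq> {u, v}"
    have "E1 - {{v, y}} = E12"
      unfolding del[symmetric] assms(5,6) by blast
    then have "sep V E1 {v, y} = 0"
      using conn_E12 by (intro sep_0) simp
    \<comment> \<open>The general bound 104 for \<open>{v, u'}\<close> exceeds 84, so the intact
      right triangle is needed to rule out \<open>{v, u'}\<close> and
      \<open>{u', y}\<close>.\<close>
    then have "sep V E1 {v, y} < 84" "sep V E1 {v, u'} < 84" "sep V E1 {u', y} < 84"
      "sep V E1 {x, w} < 84" "sep V E1 {w, u} < 84"
      using sep_0[OF vu''] sep_0[OF u'y'] sep_xw[OF sub(1)] sep_wu[OF sub(1)] by linarith+
    moreover have "sep V E1 f < 84" if "f \<in> K"
      using sep_K[OF that sub(1)] by linarith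
    ultimately have "sep V E1 f < 84"
      using f unfolding E1_def by blast
    then show "sep V E1 f < sep V E1 {u, v}"
      by (simp add: E1_uv)
  qed (use sub in \<open>auto simp: E1_def\<close>)
  then have cost1: "individual_cost \<alpha> V E1 v = ereal (3 * \<alpha> + 3)"
    by (simp add: deg E1_uv)

  have "individual_cost \<alpha> V E2 v = ereal (\<alpha> * real (degree E2 v) + real (rel V E2 {u', y} v))"
  proof (rule individual_cost_unique_target[OF conn fin(3)])
    fix f assume f: "f \<in> E2" "f \<noteq> {u', y}"
    have "E2 - {{w, v}} = E12"
      unfolding del[symmetric] assms(5,6) by blast
    then have "sep V E2 {w, v} = 0"
      using conn_E12 by (intro sep_0) simp
    then have "sep V E2 {w, v} < 120" "sep V E2 {v, u'} < 120" "sep V E2 {u, v} < 120"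
      "sep V E2 {x, w} < 120" "sep V E2 {w, u} < 120"
      using sep_vu'[OF sub(2)] sep_uv[OF sub(2)] sep_xw[OF sub(2)] sep_wu[OF sub(2)] by linarith+
    moreover have "sep V E2 f < 120" if "f \<in> K"
      using sep_K[OF that sub(2)] by linarith
    ultimately have "sep V E2 f < 120"
      using f unfolding E2_def by blast
    then show "sep V E2 f < sep V E2 {u', y}"
      using sub by (simp add: E2_u'y)
  qed (use sub in \<open>auto simp: E2_def\<close>)
  then have cost2: "individual_cost \<alpha> V E2 v = ereal (3 * \<alpha> + 12)"
    using sub by (simp add: deg E2_u'y)

  have "individual_cost \<alpha> V E12 v = ereal (\<alpha> * real (degree E12 v) + real (rel V E12 {u', y} v))"
  proof (rule individual_cost_unique_target[OF conn fin(4)])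
    fix f assume f: "f \<in> E12" "f \<noteq> {u', y}"
    have "sep V E12 {v, u'} < 120" "sep V E12 {u, v} < 120"
      "sep V E12 {x, w} < 120" "sep V E12 {w, u} < 120"
      using sep_vu'[OF subset_refl] sep_uv[OF subset_refl] sep_xw[OF subset_refl]
        sep_wu[OF subset_refl] by linarith+
    moreover have "sep V E12 f < 120" if "f \<in> K"
      using sep_K[OF that subset_refl] by linarith
    ultimately have "sep V E12 f < 120"
      using f unfolding E12_def by blast
    then show "sep V E12 f < sep V E12 {u', y}"
      using sub by (simp add: E2_u'y)
  qed (auto simp: E12_def)
  then have cost12: "individual_cost \<alpha> V E12 v = ereal (2 * \<alpha> + 12)"
    using sub by (simp add: deg E2_u'y)

  \<comment> \<open>Comparison of the increments\<close>
  have lt: "individual_cost \<alpha> V (E - {e1, e2}) v - individual_cost \<alpha> V E v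
      < (individual_cost \<alpha> V (E - {e1}) v - individual_cost \<alpha> V E v)
        + (individual_cost \<alpha> V (E - {e2}) v - individual_cost \<alpha> V E v)"
    \<comment> \<open>All four costs are finite, and both sides contain the same multiple of
      \<open>\<alpha>\<close>, so only 11 < 13 remains, whatever the link cost.\<close>
    unfolding del cost cost1 cost2 cost12 by simp
  \<comment> \<open>Distinctness makes the sum over \<open>{e1, e2}\<close> in
    \<open>cost_convex\<close> have two terms.\<close>
  have e12: "e1 \<noteq> e2" "{e1, e2} \<subseteq> {e \<in> E. v \<in> e}"
    using facts by (auto simp: assms(5,6) E doubleton_eq_iff)
  have "\<not> cost_convex \<alpha> V E v"
  proof
    assume "cost_convex \<alpha> V E v"
    then have "(\<Sum>e\<in>{e1, e2}. individual_cost \<alpha> V (E - {e}) v - individual_cost \<alpha> V E v)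
        \<le> individual_cost \<alpha> V (E - {e1, e2}) v - individual_cost \<alpha> V E v"
      using e12(2) unfolding cost_convex_def by blast
    with lt e12(1) show False
      by (simp add: leD)
  qed
  with lt show ?thesis
    by blast
qed

end
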